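(* Let $P$ be a poset in which every principal order ideal is finite. Suppose $\delta,\lambda\in J(P)$ are such that $\delta\subseteq\lambda$ and every non-maximal element of $\delta$ is less than at least $2$ maximal elements of $\delta$. Then for every $\mu\in J(P)$ with $\mu\subseteq\delta\setminus\max(\delta)$, the lattice $J(\lambda\setminus\mu)$ is an Atniss win if and only if the lattice $J(\lambda)$ is an Atniss win.
   Context: $J(Q)$ denotes the lattice of finite order ideals of a poset $Q$, ordered by containment; subsets of $P$ (such as $\lambda\setminus\mu$) are viewed as induced subposets. $\max(Q)$ is the set of maximal elements of $Q$. Ungar game: for a finite lattice $L$ and $x\in L$, an Ungar move sends $x$ to $\bigwedge(\{x\}\cup T)$ with $T$ a subset of the elements covered by $x$; it is nontrivial if $T\ne\emptyset$. (In $J(Q)$ this means removing a subset of the maximal elements of an ideal.) Starting at the top element $\hat1$, Atniss (first) and Eeta alternately make nontrivial Ungar moves; the player who cannot move (i.e. faces $\hat0$) loses. $L$ is an Atniss win if Atniss has a winning strategy, otherwise an Eeta win. *)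

theory Defs
  imports "HOL-Algebra.Lattice"
begin

text \<open>Posets are represented by their carrier, as in HOL-Algebra; the subposet of \<open>P\<close> induced on
  \<open>A\<close> is \<open>P\<lparr>carrier := A\<rparr>\<close>.\<close>

definition ideal_lattice :: "('a, 'b) gorder_scheme \<Rightarrow> 'a set gorder"
  where "ideal_lattice Q =
    \<lparr>carrier = {I. I \<subseteq> carrier Q \<and> finite I \<and>
                    (\<forall>x\<in>I. \<forall>y\<in>carrier Q. y \<sqsubseteq>\<^bsub>Q\<^esub> x \<longrightarrow> y \<in> I)},
     eq = (=), le = (\<subseteq>)\<rparr>"

definition maximal_elements :: "('a, 'b) gorder_scheme \<Rightarrow> 'a set"
  where "maximal_elements Q = {x \<in> carrier Q. \<not> (\<exists>y\<in>carrier Q. x \<sqsubset>\<^bsub>Q\<^esub> y)}"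

definition lower_covers :: "('a, 'b) gorder_scheme \<Rightarrow> 'a \<Rightarrow> 'a set"
  where "lower_covers L x =
    {y \<in> carrier L. y \<sqsubset>\<^bsub>L\<^esub> x \<and> \<not> (\<exists>z\<in>carrier L. y \<sqsubset>\<^bsub>L\<^esub> z \<and> z \<sqsubset>\<^bsub>L\<^esub> x)}"

definition nontrivial_ungar_move :: "('a, 'b) gorder_scheme \<Rightarrow> 'a \<Rightarrow> 'a \<Rightarrow> bool"
  where "nontrivial_ungar_move L x y \<longleftrightarrow>
    (\<exists>T. T \<subseteq> lower_covers L x \<and> T \<noteq> {} \<and> y = \<Sqinter>\<^bsub>L\<^esub>({x} \<union> T))"

text \<open>A partial play of the Ungar game is the nonempty list of positions visited so far, in
  chronological order. Since Atniss moves first, it is her turn exactly when this list has odd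
  length.\<close>

definition ungar_play :: "('a, 'b) gorder_scheme \<Rightarrow> 'a list \<Rightarrow> bool"
  where "ungar_play L xs \<longleftrightarrow>
    xs \<noteq> [] \<and> hd xs = \<top>\<^bsub>L\<^esub> \<and> successively (nontrivial_ungar_move L) xs"

definition ungar_play_over :: "('a, 'b) gorder_scheme \<Rightarrow> 'a list \<Rightarrow> bool"
  where "ungar_play_over L xs \<longleftrightarrow>
    ungar_play L xs \<and> \<not> (\<exists>y. nontrivial_ungar_move L (last xs) y)"

definition atniss_strategy :: "('a, 'b) gorder_scheme \<Rightarrow> ('a list \<Rightarrow> 'a) \<Rightarrow> bool"
  where "atniss_strategy L \<sigma> \<longleftrightarrow>
    (\<forall>xs. ungar_play L xs \<and> odd (length xs) \<and> \<not> ungar_play_over L xs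
       \<longrightarrow> nontrivial_ungar_move L (last xs) (\<sigma> xs))"

definition atniss_follows :: "('a list \<Rightarrow> 'a) \<Rightarrow> 'a list \<Rightarrow> bool"
  where "atniss_follows \<sigma> xs \<longleftrightarrow>
    (\<forall>n. odd n \<and> n < length xs \<longrightarrow> xs ! n = \<sigma> (take n xs))"

text \<open>The definition below is meant for finite lattices, where every play is finite. A finished
  play of even length is one in which Eeta is unable to move.\<close>

definition atniss_win :: "('a, 'b) gorder_scheme \<Rightarrow> bool"
  where "atniss_win L \<longleftrightarrow>
    (\<exists>\<sigma>. atniss_strategy L \<sigma> \<and>
         (\<forall>xs. ungar_play_over L xs \<and> atniss_follows \<sigma> xs \<longrightarrow> even (length xs)))"

end

theory Submission
  imports Defs
begin

text \<open>In \<open>J(Q)\<close> a move deletes a nonempty set of maximal elements, so the game only depends on the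
  induced poset that is left. If deleting a maximal element \<open>m\<close> creates no new maximal elements,
  then the player to move wins: delete \<open>m\<close> if this leaves a losing position, and otherwise delete
  \<open>m\<close> together with the winning reply. As long as \<open>\<delta>\<close> is intact, the maximal elements of a
  position \<open>I\<close> do not change when \<open>\<mu>\<close> is removed from it. If one of them is maximal in \<open>\<delta>\<close>,
  then deleting it creates no new maximal elements, by the hypothesis on \<open>\<delta>\<close>, so both positions
  are wins; otherwise every move keeps \<open>\<delta>\<close> intact, and induction applies.\<close>

section \<open>Normal play\<close>

inductive mover_wins :: "('a \<Rightarrow> 'a \<Rightarrow> bool) \<Rightarrow> 'a \<Rightarrow> bool" for R
  where mover_winsI: "R x y \<Longrightarrow> \<forall>z. R y z \<longrightarrow> mover_wins R z \<Longrightarrow> mover_wins R x"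

lemma mover_wins_iff:
  assumes "termip R x"
  shows "mover_wins R x \<longleftrightarrow> (\<exists>y. R x y \<and> \<not> mover_wins R y)"
  using assms
proof (induction rule: accp_induct_rule [case_names step])
  case (step x)
  then have "\<not> mover_wins R y \<longleftrightarrow> (\<forall>z. R y z \<longrightarrow> mover_wins R z)" if "R x y" for y
    using that by auto
  then show ?case
    by (subst mover_wins.simps) blast
qed

lemma mover_wins_mono_on:
  assumes "mover_wins R x" and "x \<in> A"
    and move_iff: "\<And>x y. x \<in> A \<Longrightarrow> R x y \<longleftrightarrow> R' x y"
    and closed: "\<And>x y. x \<in> A \<Longrightarrow> R x y \<Longrightarrow> y \<in> A"
  shows "mover_wins R' x"
  using assms(1,2)
proof (induction rule: mover_wins.induct)
  case (mover_winsI x y)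
  then have "R' x y" and "y \<in> A"
    using move_iff[of x] closed[of x] by simp_all
  moreover have "\<forall>z. R' y z \<longrightarrow> mover_wins R' z"
    using mover_winsI.IH move_iff[OF \<open>y \<in> A\<close>] closed[OF \<open>y \<in> A\<close>] by simp
  ultimately show ?case
    by (blast intro: mover_wins.mover_winsI)
qed

lemma mover_wins_cong_on:
  assumes "x \<in> A"
    and "\<And>x y. x \<in> A \<Longrightarrow> R x y \<longleftrightarrow> R' x y"
    and "\<And>x y. x \<in> A \<Longrightarrow> R x y \<Longrightarrow> y \<in> A"
  shows "mover_wins R x \<longleftrightarrow> mover_wins R' x"
  using mover_wins_mono_on[of R x A R'] mover_wins_mono_on[of R' x A R] assms by blast

lemma termip_if_psubset_on:
  assumes "finite I" and "I \<in> A"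
    and move: "\<And>I J. I \<in> A \<Longrightarrow> R I J \<Longrightarrow> J \<in> A \<and> J \<subset> I"
  shows "termip R I"
  using assms(1,2)
proof (induction rule: finite_psubset_induct)
  case (psubset I)
  have "termip R J" if "R I J" for J
    using psubset.IH[of J] psubset.prems move[OF _ that] by blast
  then show ?case
    by (blast intro: accp.accI elim: conversepE)
qed

definition best_reply :: "('a \<Rightarrow> 'a \<Rightarrow> bool) \<Rightarrow> 'a \<Rightarrow> 'a"
  where "best_reply R x = (SOME y. R x y \<and> (mover_wins R x \<longrightarrow> \<not> mover_wins R y))"

lemma best_reply:
  assumes "termip R x" and "R x y"
  shows "R x (best_reply R x)"
    and "mover_wins R x \<Longrightarrow> \<not> mover_wins R (best_reply R x)"
proof -
  have "\<exists>y. R x y \<and> (mover_wins R x \<longrightarrow> \<not> mover_wins R y)"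
    using assms mover_wins_iff[OF assms(1)] by blast
  then have "R x (best_reply R x) \<and> (mover_wins R x \<longrightarrow> \<not> mover_wins R (best_reply R x))"
    unfolding best_reply_def by (rule someI_ex)
  then show "R x (best_reply R x)"
    and "mover_wins R x \<Longrightarrow> \<not> mover_wins R (best_reply R x)"
    by blast+
qed

section \<open>Strategies in the Ungar game\<close>

lemma ungar_play_singleton: "ungar_play L [x] \<longleftrightarrow> x = \<top>\<^bsub>L\<^esub>"
  by (simp add: ungar_play_def)

lemma ungar_play_snoc:
  assumes "xs \<noteq> []"
  shows "ungar_play L (xs @ [y]) \<longleftrightarrow> ungar_play L xs \<and> nontrivial_ungar_move L (last xs) y"
  using assms by (auto simp: ungar_play_def successively_append_iff)

lemma ungar_play_induct [consumes 1, case_names top snoc]: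
  assumes "ungar_play L xs"
    and "Q [\<top>\<^bsub>L\<^esub>]"
    and "\<And>xs y. ungar_play L xs \<Longrightarrow> nontrivial_ungar_move L (last xs) y \<Longrightarrow> Q xs \<Longrightarrow> Q (xs @ [y])"
  shows "Q xs"
  using assms(1)
proof (induction xs rule: rev_induct)
  case Nil
  then show ?case
    by (simp add: ungar_play_def)
next
  case (snoc y xs)
  with assms(2,3) show ?case
    by (cases "xs = []") (auto simp: ungar_play_singleton ungar_play_snoc)
qed

lemma atniss_follows_singleton: "atniss_follows \<sigma> [x]"
  by (simp add: atniss_follows_def)

lemma atniss_follows_snoc:
  "atniss_follows \<sigma> (xs @ [y]) \<longleftrightarrow> atniss_follows \<sigma> xs \<and> (odd (length xs) \<longrightarrow> y = \<sigma> xs)"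
  by (auto simp: atniss_follows_def nth_append less_Suc_eq)

definition atniss_ahead :: "('a, 'b) gorder_scheme \<Rightarrow> 'a list \<Rightarrow> bool"
  where "atniss_ahead L xs \<longleftrightarrow>
    (odd (length xs) \<longleftrightarrow> mover_wins (nontrivial_ungar_move L) (last xs))"

lemma atniss_ahead_singleton:
  "atniss_ahead L [x] \<longleftrightarrow> mover_wins (nontrivial_ungar_move L) x"
  by (simp add: atniss_ahead_def)

lemma atniss_ahead_snoc:
  "atniss_ahead L (xs @ [y]) \<longleftrightarrow>
    (even (length xs) \<longleftrightarrow> mover_wins (nontrivial_ungar_move L) y)"
  by (simp add: atniss_ahead_def)

lemma even_length_if_ungar_play_over:
  assumes "ungar_play_over L xs" and "atniss_ahead L xs"
  shows "even (length xs)"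
  using assms by (auto simp: ungar_play_over_def atniss_ahead_def elim: mover_wins.cases)

lemma termip_last_ungar_play:
  assumes "ungar_play L xs" and "termip (nontrivial_ungar_move L) \<top>\<^bsub>L\<^esub>"
  shows "termip (nontrivial_ungar_move L) (last xs)"
  using assms(1)
proof (induction rule: ungar_play_induct)
  case top
  with assms(2) show ?case
    by (simp only: last_ConsL)
next
  case (snoc xs y)
  then show ?case
    by (auto intro: accp_downward)
qed

lemma atniss_ahead_if_follows_best_reply:
  assumes "ungar_play L xs" and "termip (nontrivial_ungar_move L) \<top>\<^bsub>L\<^esub>"
    and "mover_wins (nontrivial_ungar_move L) \<top>\<^bsub>L\<^esub>"
    and "atniss_follows (best_reply (nontrivial_ungar_move L) \<circ> last) xs"
  shows "atniss_ahead L xs"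
  using assms(1,4)
proof (induction rule: ungar_play_induct)
  case top
  with assms(3) show ?case
    by (simp add: atniss_ahead_singleton)
next
  case (snoc xs y)
  have terminates: "termip (nontrivial_ungar_move L) (last xs)"
    using snoc.hyps(1) assms(2) by (rule termip_last_ungar_play)
  have ahead: "atniss_ahead L xs"
    and reply: "odd (length xs) \<Longrightarrow> y = best_reply (nontrivial_ungar_move L) (last xs)"
    using snoc.IH snoc.prems by (auto simp: atniss_follows_snoc)
  show ?case
  proof (cases "odd (length xs)")
    case True
    with ahead reply best_reply(2)[OF terminates snoc.hyps(2)] show ?thesis
      by (simp add: atniss_ahead_snoc atniss_ahead_def[of L xs])
  next
    case False
    with ahead snoc.hyps(2) mover_wins_iff[OF terminates] show ?thesis
      by (auto simp: atniss_ahead_snoc atniss_ahead_def[of L xs])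
  qed
qed

lemma atniss_win_if_mover_wins:
  assumes "termip (nontrivial_ungar_move L) \<top>\<^bsub>L\<^esub>"
    and "mover_wins (nontrivial_ungar_move L) \<top>\<^bsub>L\<^esub>"
  shows "atniss_win L"
proof -
  let ?\<sigma> = "best_reply (nontrivial_ungar_move L) \<circ> last"
  have "atniss_strategy L ?\<sigma>"
    unfolding atniss_strategy_def
    using best_reply(1)[OF termip_last_ungar_play[OF _ assms(1)]]
    by (auto simp: ungar_play_over_def)
  moreover have "even (length xs)" if "ungar_play_over L xs" "atniss_follows ?\<sigma> xs" for xs
    using that atniss_ahead_if_follows_best_reply[OF _ assms] even_length_if_ungar_play_over
    by (auto simp: ungar_play_over_def)
  ultimately show ?thesis
    unfolding atniss_win_def by blast
qed

lemma atniss_ahead_if_follows_winning_strategy: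
  assumes strategy: "atniss_strategy L \<sigma>"
    and winning: "\<forall>xs. ungar_play_over L xs \<and> atniss_follows \<sigma> xs \<longrightarrow> even (length xs)"
    and "termip (nontrivial_ungar_move L) x"
    and "ungar_play L xs" and "atniss_follows \<sigma> xs" and "last xs = x"
  shows "atniss_ahead L xs"
  using assms(3-)
proof (induction arbitrary: xs rule: accp_induct_rule [case_names step])
  case (step x)
  have "xs \<noteq> []"
    using step.prems(1) by (auto simp: ungar_play_def)
  then have ahead_snoc: "atniss_ahead L (xs @ [y])"
    if "nontrivial_ungar_move L (last xs) y" "odd (length xs) \<Longrightarrow> y = \<sigma> xs" for y
    using that step.prems by (intro step.IH[of y]) (auto simp: ungar_play_snoc atniss_follows_snoc)
  have wins_iff: "mover_wins (nontrivial_ungar_move L) (last xs) \<longleftrightarrow>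
      (\<exists>y. nontrivial_ungar_move L (last xs) y \<and> \<not> mover_wins (nontrivial_ungar_move L) y)"
    using step.hyps step.prems(3) by (intro mover_wins_iff) simp
  show ?case
  proof (cases "odd (length xs)")
    case True
    then have "nontrivial_ungar_move L (last xs) (\<sigma> xs)"
      using strategy winning step.prems unfolding atniss_strategy_def by blast
    with True ahead_snoc[of "\<sigma> xs"] wins_iff show ?thesis
      by (auto simp: atniss_ahead_snoc atniss_ahead_def[of L xs])
  next
    case False
    with ahead_snoc wins_iff show ?thesis
      by (auto simp: atniss_ahead_snoc atniss_ahead_def[of L xs])
  qed
qed

lemma atniss_win_iff_mover_wins:
  assumes "termip (nontrivial_ungar_move L) \<top>\<^bsub>L\<^esub>"
  shows "atniss_win L \<longleftrightarrow> mover_wins (nontrivial_ungar_move L) \<top>\<^bsub>L\<^esub>"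
proof
  assume "atniss_win L"
  then obtain \<sigma> where "atniss_strategy L \<sigma>"
    and "\<forall>xs. ungar_play_over L xs \<and> atniss_follows \<sigma> xs \<longrightarrow> even (length xs)"
    unfolding atniss_win_def by blast
  then have "atniss_ahead L [\<top>\<^bsub>L\<^esub>]"
    using assms by (rule atniss_ahead_if_follows_winning_strategy)
      (simp_all add: ungar_play_singleton atniss_follows_singleton)
  then show "mover_wins (nontrivial_ungar_move L) \<top>\<^bsub>L\<^esub>"
    by (simp add: atniss_ahead_singleton)
qed (rule atniss_win_if_mover_wins[OF assms])

section \<open>Maximal elements and lattices of ideals\<close>

abbreviation maximals :: "('a, 'b) gorder_scheme \<Rightarrow> 'a set \<Rightarrow> 'a set"
  where "maximals P A \<equiv> maximal_elements (P\<lparr>carrier := A\<rparr>)"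

lemma mem_maximals_iff: "x \<in> maximals P A \<longleftrightarrow> x \<in> A \<and> (\<forall>y\<in>A. \<not> x \<sqsubset>\<^bsub>P\<^esub> y)"
  by (auto simp: maximal_elements_def lless_def)

lemma maximals_subset: "maximals P A \<subseteq> A"
  by (auto simp: mem_maximals_iff)

lemma maximals_Int_subset:
  assumes "A \<subseteq> B"
  shows "maximals P B \<inter> A \<subseteq> maximals P A"
  using assms by (auto simp: mem_maximals_iff subset_iff)

lemma (in partial_order) maximals_nonempty:
  assumes "finite A" and "A \<noteq> {}" and "A \<subseteq> carrier L"
  shows "maximals L A \<noteq> {}"
proof -
  have "asymp_on A (\<sqsubset>)"
    using assms(3) by (intro asymp_onI) (blast intro: lless_antisym)
  moreover have "transp_on A (\<sqsubset>)"
    using assms(3) by (intro transp_onI) (blast intro: lless_trans)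
  ultimately obtain m where "m \<in> A" "\<forall>x\<in>A. x \<noteq> m \<longrightarrow> \<not> m \<sqsubset> x"
    using Finite_Set.bex_max_element assms(1,2) by blast
  then have "m \<in> maximals L A"
    by (auto simp: mem_maximals_iff lless_eq)
  then show ?thesis
    by blast
qed

lemma mem_ideal_lattice_iff:
  "I \<in> carrier (ideal_lattice Q) \<longleftrightarrow>
    I \<subseteq> carrier Q \<and> finite I \<and> (\<forall>x\<in>I. \<forall>y\<in>carrier Q. y \<sqsubseteq>\<^bsub>Q\<^esub> x \<longrightarrow> y \<in> I)"
  by (simp add: ideal_lattice_def)

lemma ideal_downward_closed:
  assumes "I \<in> carrier (ideal_lattice Q)" and "x \<in> I" and "y \<in> carrier Q" and "y \<sqsubset>\<^bsub>Q\<^esub> x"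
  shows "y \<in> I"
  using assms by (auto simp: mem_ideal_lattice_iff dest: lless_imp_le)

lemma ideal_lattice_le [simp]: "I \<sqsubseteq>\<^bsub>ideal_lattice Q\<^esub> J \<longleftrightarrow> I \<subseteq> J"
  by (simp add: ideal_lattice_def)

lemma ideal_lattice_less [simp]: "I \<sqsubset>\<^bsub>ideal_lattice Q\<^esub> J \<longleftrightarrow> I \<subset> J"
  by (auto simp: ideal_lattice_def lless_def)

lemma partial_order_ideal_lattice: "partial_order (ideal_lattice Q)"
  by unfold_locales (auto simp: ideal_lattice_def)

lemma carrier_mem_ideal_lattice:
  assumes "finite (carrier Q)"
  shows "carrier Q \<in> carrier (ideal_lattice Q)"
  using assms by (auto simp: mem_ideal_lattice_iff)

lemma ideal_lattice_top:
  assumes "finite (carrier Q)"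
  shows "\<top>\<^bsub>ideal_lattice Q\<^esub> = carrier Q"
proof -
  have "greatest (ideal_lattice Q) (carrier Q) (carrier (ideal_lattice Q))"
    using carrier_mem_ideal_lattice[OF assms] by (auto simp: greatest_def mem_ideal_lattice_iff)
  then show ?thesis
    unfolding top_def by (rule some_equality)
      (rule partial_order.greatest_unique[OF partial_order_ideal_lattice _ \<open>greatest _ _ _\<close>])
qed

lemma ideal_lattice_inf:
  assumes "\<I> \<subseteq> carrier (ideal_lattice Q)" and "\<I> \<noteq> {}"
  shows "\<Sqinter>\<^bsub>ideal_lattice Q\<^esub>\<I> = \<Inter>\<I>"
proof -
  have "\<Inter>\<I> \<in> carrier (ideal_lattice Q)"
    using assms by (fastforce simp: mem_ideal_lattice_iff intro: finite_Inter)
  then have "greatest (ideal_lattice Q) (\<Inter>\<I>) (Lower (ideal_lattice Q) \<I>)"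
    using assms(1) by (intro greatest_LowerI) (auto simp: Lower_def)
  then show ?thesis
    unfolding inf_def by (rule some_equality)
      (rule partial_order.greatest_unique[OF partial_order_ideal_lattice _ \<open>greatest _ _ _\<close>])
qed

lemma (in partial_order) ideal_Diff_maximals:
  assumes "I \<in> carrier (ideal_lattice L)" and "S \<subseteq> maximals L I"
  shows "I - S \<in> carrier (ideal_lattice L)"
proof -
  have "y \<notin> S" if "x \<in> I - S" "y \<sqsubseteq> x" for x y
    using that assms(2) by (auto simp: mem_maximals_iff lless_eq subset_iff)
  with assms(1) show ?thesis
    by (auto simp: mem_ideal_lattice_iff)
qed

lemma maximals_Diff_ideal_subset:
  assumes "J \<in> carrier (ideal_lattice P)" and "I \<subseteq> carrier P"
  shows "maximals P (I - J) \<subseteq> maximals P I"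
proof
  fix x
  assume x: "x \<in> maximals P (I - J)"
  then have "\<not> x \<sqsubset>\<^bsub>P\<^esub> y" if "y \<in> J" for y
    using assms(2) ideal_downward_closed[OF assms(1) that, of x] by (auto simp: mem_maximals_iff)
  with x show "x \<in> maximals P I"
    by (auto simp: mem_maximals_iff)
qed

lemma maximals_Diff_ideal:
  assumes "J \<in> carrier (ideal_lattice P)" and "I \<subseteq> carrier P" and "maximals P I \<inter> J = {}"
  shows "maximals P (I - J) = maximals P I"
proof
  show "maximals P (I - J) \<subseteq> maximals P I"
    using assms(1,2) by (rule maximals_Diff_ideal_subset)
  show "maximals P I \<subseteq> maximals P (I - J)"
    using assms(3) by (auto simp: mem_maximals_iff)
qed

lemma (in partial_order) lower_covers_ideal_lattice:
  assumes I: "I \<in> carrier (ideal_lattice L)"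
  shows "lower_covers (ideal_lattice L) I = (\<lambda>m. I - {m}) ` maximals L I"
proof
  show "lower_covers (ideal_lattice L) I \<subseteq> (\<lambda>m. I - {m}) ` maximals L I"
  proof
    fix J
    assume "J \<in> lower_covers (ideal_lattice L) I"
    then have J: "J \<in> carrier (ideal_lattice L)" "J \<subset> I"
      and cover: "\<And>K. K \<in> carrier (ideal_lattice L) \<Longrightarrow> J \<subset> K \<Longrightarrow> \<not> K \<subset> I"
      by (auto simp: lower_covers_def)
    obtain m where m: "m \<in> maximals L (I - J)"
      using maximals_nonempty[of "I - J"] I J(2) by (auto simp: mem_ideal_lattice_iff)
    then have "m \<in> maximals L I"
      using maximals_Diff_ideal_subset[OF J(1)] I by (auto simp: mem_ideal_lattice_iff)
    moreover from this have "J = I - {m}"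
      using cover[of "I - {m}"] ideal_Diff_maximals[OF I, of "{m}"] m J(2)
      by (auto simp: mem_maximals_iff)
    ultimately show "J \<in> (\<lambda>m. I - {m}) ` maximals L I"
      by blast
  qed
  show "(\<lambda>m. I - {m}) ` maximals L I \<subseteq> lower_covers (ideal_lattice L) I"
    using ideal_Diff_maximals[OF I] by (auto simp: lower_covers_def mem_maximals_iff)
qed

section \<open>The removal game\<close>

definition removal_move :: "('a, 'b) gorder_scheme \<Rightarrow> 'a set \<Rightarrow> 'a set \<Rightarrow> bool"
  where "removal_move P I J \<longleftrightarrow> (\<exists>S \<subseteq> maximals P I. S \<noteq> {} \<and> J = I - S)"

lemma removal_move_psubset:
  assumes "removal_move P I J"
  shows "J \<subset> I"
  using assms maximals_subset[where A = I] by (auto simp: removal_move_def)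

lemma removal_move_restrict [simp]: "removal_move (P\<lparr>carrier := A\<rparr>) = removal_move P"
  by (intro ext) (simp add: removal_move_def)

lemma termip_removal_move:
  assumes "finite I"
  shows "termip (removal_move P) I"
  using assms removal_move_psubset by (intro termip_if_psubset_on[where A = UNIV]) auto

lemma mover_wins_removal_move_iff:
  assumes "finite I"
  shows "mover_wins (removal_move P) I \<longleftrightarrow>
    (\<exists>S \<subseteq> maximals P I. S \<noteq> {} \<and> \<not> mover_wins (removal_move P) (I - S))"
  by (subst mover_wins_iff[OF termip_removal_move[OF assms]]) (auto simp: removal_move_def)

lemma (in partial_order) removal_move_ideal:
  assumes "I \<in> carrier (ideal_lattice L)" and "removal_move L I J"
  shows "J \<in> carrier (ideal_lattice L)"
  using assms ideal_Diff_maximals by (auto simp: removal_move_def)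

lemma (in partial_order) nontrivial_ungar_move_ideal_lattice:
  assumes I: "I \<in> carrier (ideal_lattice L)"
  shows "nontrivial_ungar_move (ideal_lattice L) I J \<longleftrightarrow> removal_move L I J"
proof -
  have inf_eq: "\<Sqinter>\<^bsub>ideal_lattice L\<^esub>({I} \<union> (\<lambda>m. I - {m}) ` S) = I - S"
    if "S \<subseteq> maximals L I" for S
  proof -
    have "{I} \<union> (\<lambda>m. I - {m}) ` S \<subseteq> carrier (ideal_lattice L)"
      using I ideal_Diff_maximals[OF I] that by auto
    then have "\<Sqinter>\<^bsub>ideal_lattice L\<^esub>({I} \<union> (\<lambda>m. I - {m}) ` S) = \<Inter>({I} \<union> (\<lambda>m. I - {m}) ` S)"
      by (rule ideal_lattice_inf) simp
    also have "\<dots> = I - S"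
      by auto
    finally show ?thesis .
  qed
  have "nontrivial_ungar_move (ideal_lattice L) I J \<longleftrightarrow> (\<exists>S \<subseteq> maximals L I.
      (\<lambda>m. I - {m}) ` S \<noteq> {} \<and> J = \<Sqinter>\<^bsub>ideal_lattice L\<^esub>({I} \<union> (\<lambda>m. I - {m}) ` S))"
    unfolding nontrivial_ungar_move_def lower_covers_ideal_lattice[OF I] subset_image_iff
    by blast
  also have "\<dots> \<longleftrightarrow> removal_move L I J"
    unfolding removal_move_def using inf_eq by (simp del: Un_insert_left) blast
  finally show ?thesis .
qed

lemma (in partial_order) atniss_win_ideal_lattice_iff:
  assumes "finite (carrier L)"
  shows "atniss_win (ideal_lattice L) \<longleftrightarrow> mover_wins (removal_move L) (carrier L)"
proof -
  let ?J = "ideal_lattice L"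
  note move_iff = nontrivial_ungar_move_ideal_lattice
  have carrier_ideal: "carrier L \<in> carrier ?J"
    using assms by (rule carrier_mem_ideal_lattice)
  with assms have "termip (nontrivial_ungar_move ?J) (carrier L)"
    by (rule termip_if_psubset_on) (simp add: move_iff removal_move_ideal removal_move_psubset)
  then have "atniss_win ?J \<longleftrightarrow> mover_wins (nontrivial_ungar_move ?J) (carrier L)"
    using atniss_win_iff_mover_wins[of ?J] by (simp add: ideal_lattice_top[OF assms])
  also have "\<dots> \<longleftrightarrow> mover_wins (removal_move L) (carrier L)"
    using carrier_ideal move_iff removal_move_ideal
    by (intro mover_wins_cong_on[of _ "carrier ?J"]) auto
  finally show ?thesis .
qed

lemma (in partial_order) partial_order_subset:
  assumes "A \<subseteq> carrier L"
  shows "partial_order (L\<lparr>carrier := A\<rparr>)"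
  using weak_partial_order_subset[OF weak_partial_order_axioms assms]
  by (simp add: partial_order_def partial_order_axioms_def eq_is_equal)

lemma (in partial_order) atniss_win_subposet_iff:
  assumes "finite A" and "A \<subseteq> carrier L"
  shows "atniss_win (ideal_lattice (L\<lparr>carrier := A\<rparr>)) \<longleftrightarrow> mover_wins (removal_move L) A"
  using partial_order.atniss_win_ideal_lattice_iff[OF partial_order_subset[OF assms(2)]] assms(1)
  by simp

lemma mover_wins_removal_move_cong:
  assumes "finite I" and "finite J" and maximals_eq: "maximals P I = maximals P J"
    and "\<And>S. S \<subseteq> maximals P J \<Longrightarrow> S \<noteq> {} \<Longrightarrow>
      mover_wins (removal_move P) (I - S) \<longleftrightarrow> mover_wins (removal_move P) (J - S)"
  shows "mover_wins (removal_move P) I \<longleftrightarrow> mover_wins (removal_move P) J"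
  unfolding mover_wins_removal_move_iff[OF assms(1)] mover_wins_removal_move_iff[OF assms(2)]
    maximals_eq
  using assms(4) by blast

lemma mover_wins_if_no_new_maximals:
  assumes "finite I" and m: "m \<in> maximals P I"
    and no_new: "maximals P (I - {m}) \<subseteq> maximals P I"
  shows "mover_wins (removal_move P) I"
proof (cases "mover_wins (removal_move P) (I - {m})")
  case True
  then obtain S where "S \<subseteq> maximals P (I - {m})"
    and lose: "\<not> mover_wins (removal_move P) (I - {m} - S)"
    using assms(1) by (subst (asm) mover_wins_removal_move_iff) auto
  with m no_new have "insert m S \<subseteq> maximals P I"
    by blast
  moreover have "I - insert m S = I - {m} - S"
    by blast
  ultimately show ?thesis
    using lose by (subst mover_wins_removal_move_iff[OF assms(1)]) (metis insert_not_empty)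
next
  case False
  with m show ?thesis
    by (subst mover_wins_removal_move_iff[OF assms(1)]) blast
qed

section \<open>Doubly dominated ideals\<close>

definition doubly_dominated :: "('a, 'b) gorder_scheme \<Rightarrow> 'a set \<Rightarrow> bool"
  where "doubly_dominated P A \<longleftrightarrow>
    (\<forall>x \<in> A - maximals P A. card {m \<in> maximals P A. x \<sqsubset>\<^bsub>P\<^esub> m} \<ge> 2)"

lemma doubly_dominated_obtain_other:
  assumes "doubly_dominated P A" and "x \<in> A - maximals P A"
  obtains m' where "m' \<in> maximals P A" and "m' \<noteq> m" and "x \<sqsubset>\<^bsub>P\<^esub> m'"
proof -
  have "\<not> {m' \<in> maximals P A. x \<sqsubset>\<^bsub>P\<^esub> m'} \<subseteq> {m}"
  proof
    assume "{m' \<in> maximals P A. x \<sqsubset>\<^bsub>P\<^esub> m'} \<subseteq> {m}"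
    then have "card {m' \<in> maximals P A. x \<sqsubset>\<^bsub>P\<^esub> m'} \<le> card {m}"
      by (intro card_mono) simp
    moreover have "card {m' \<in> maximals P A. x \<sqsubset>\<^bsub>P\<^esub> m'} \<ge> 2"
      using assms unfolding doubly_dominated_def by blast
    ultimately show False
      by simp
  qed
  with that show thesis
    by blast
qed

lemma maximals_Diff_singleton_subset:
  assumes \<delta>: "\<delta> \<in> carrier (ideal_lattice P)" "doubly_dominated P \<delta>"
    and I: "I \<subseteq> carrier P" "maximals P \<delta> \<subseteq> I"
    and m: "m \<in> maximals P \<delta>"
  shows "maximals P (I - {m}) \<subseteq> maximals P I"
proof (rule subsetI, rule ccontr)
  fix x
  assume x: "x \<in> maximals P (I - {m})" "x \<notin> maximals P I"
  then have "x \<in> I" and "x \<sqsubset>\<^bsub>P\<^esub> m"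
    by (auto simp: mem_maximals_iff)
  moreover have "m \<in> \<delta>"
    using m by (simp add: mem_maximals_iff)
  ultimately have "x \<in> \<delta> - maximals P \<delta>"
    using ideal_downward_closed[OF \<delta>(1), of m x] I(1) by (auto simp: mem_maximals_iff)
  then obtain m' where "m' \<in> maximals P \<delta>" "m' \<noteq> m" "x \<sqsubset>\<^bsub>P\<^esub> m'"
    by (rule doubly_dominated_obtain_other[OF \<delta>(2)])
  with x(1) I(2) show False
    unfolding mem_maximals_iff[of x] by blast
qed

lemma mover_wins_if_maximals_meet:
  assumes "\<delta> \<in> carrier (ideal_lattice P)" and "doubly_dominated P \<delta>"
    and "finite I" and "I \<subseteq> carrier P" and "maximals P \<delta> \<subseteq> I"
    and "maximals P I \<inter> maximals P \<delta> \<noteq> {}"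
  shows "mover_wins (removal_move P) I"
proof -
  obtain m where "m \<in> maximals P I" "m \<in> maximals P \<delta>"
    using assms(6) by blast
  then show ?thesis
    using assms(1-5) by (intro mover_wins_if_no_new_maximals maximals_Diff_singleton_subset)
qed

lemma mover_wins_Diff_iff:
  assumes \<delta>: "\<delta> \<in> carrier (ideal_lattice P)" "doubly_dominated P \<delta>"
    and \<mu>: "\<mu> \<in> carrier (ideal_lattice P)" "\<mu> \<subseteq> \<delta> - maximals P \<delta>"
    and "finite I" and "\<delta> \<subseteq> I" and "I \<subseteq> carrier P"
  shows "mover_wins (removal_move P) (I - \<mu>) \<longleftrightarrow> mover_wins (removal_move P) I"
  using assms(5-)
proof (induction rule: finite_psubset_induct)
  case (psubset I)
  have max_in_\<delta>: "maximals P I \<inter> \<delta> \<subseteq> maximals P \<delta>"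
    using psubset.prems(1) by (rule maximals_Int_subset)
  with \<mu>(2) have "maximals P I \<inter> \<mu> = {}"
    by blast
  with \<mu>(1) psubset.prems(2) have maximals_eq: "maximals P (I - \<mu>) = maximals P I"
    by (rule maximals_Diff_ideal)
  show ?case
  proof (cases "maximals P I \<inter> maximals P \<delta> = {}")
    case True
    show ?thesis
    proof (rule mover_wins_removal_move_cong[OF _ psubset.hyps maximals_eq])
      fix S
      assume S: "S \<subseteq> maximals P I" "S \<noteq> {}"
      have "\<delta> \<subseteq> I - S"
        using True S(1) max_in_\<delta> psubset.prems(1) by blast
      moreover have "I - S \<subset> I"
        using S maximals_subset[where A = I] by blast
      moreover have "I - \<mu> - S = I - S - \<mu>"
        by blast
      ultimately show "mover_wins (removal_move P) (I - \<mu> - S) \<longleftrightarrow>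
          mover_wins (removal_move P) (I - S)"
        using psubset.IH[of "I - S"] psubset.prems(2) by (simp add: Diff_subset[THEN subset_trans])
    qed (use psubset.hyps in simp)
  next
    case False
    have maximals_kept: "maximals P \<delta> \<subseteq> I - \<mu>"
      using psubset.prems(1) \<mu>(2) maximals_subset[where A = \<delta>] by blast
    have "mover_wins (removal_move P) (I - \<mu>)"
      using maximals_kept False psubset.hyps psubset.prems(2) maximals_eq
      by (intro mover_wins_if_maximals_meet[OF \<delta>]) auto
    moreover have "mover_wins (removal_move P) I"
      using maximals_kept False psubset.hyps psubset.prems(2)
      by (intro mover_wins_if_maximals_meet[OF \<delta>]) auto
    ultimately show ?thesis
      by simp
  qed
qed

theorem theorem1p7:
  fixes P :: "('a, 'b) gorder_scheme" (structure)
    and \<delta> \<Lambda> :: "'a set"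
  assumes "partial_order P"
    and "\<forall>x\<in>carrier P. finite {y \<in> carrier P. y \<sqsubseteq> x}"
    and "\<delta> \<in> carrier (ideal_lattice P)"
    and "\<Lambda> \<in> carrier (ideal_lattice P)"
    and "\<delta> \<subseteq> \<Lambda>"
    and "\<forall>x \<in> \<delta> - maximal_elements (P\<lparr>carrier := \<delta>\<rparr>).
           card {m \<in> maximal_elements (P\<lparr>carrier := \<delta>\<rparr>). x \<sqsubset> m} \<ge> 2"
  shows "\<forall>\<mu> \<in> carrier (ideal_lattice P).
           \<mu> \<subseteq> \<delta> - maximal_elements (P\<lparr>carrier := \<delta>\<rparr>) \<longrightarrow>
             (atniss_win (ideal_lattice (P\<lparr>carrier := \<Lambda> - \<mu>\<rparr>)) \<longleftrightarrow>
              atniss_win (ideal_lattice (P\<lparr>carrier := \<Lambda>\<rparr>)))"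
proof (intro ballI impI)
  fix \<mu>
  assume \<mu>: "\<mu> \<in> carrier (ideal_lattice P)" "\<mu> \<subseteq> \<delta> - maximals P \<delta>"
  note atniss_win_iff = partial_order.atniss_win_subposet_iff[OF assms(1)]
  have \<Lambda>: "finite \<Lambda>" "\<Lambda> \<subseteq> carrier P"
    using assms(4) by (auto simp: mem_ideal_lattice_iff)
  have "doubly_dominated P \<delta>"
    using assms(6) by (simp add: doubly_dominated_def)
  then have "mover_wins (removal_move P) (\<Lambda> - \<mu>) \<longleftrightarrow> mover_wins (removal_move P) \<Lambda>"
    using mover_wins_Diff_iff assms(3,5) \<mu> \<Lambda> by blast
  with \<Lambda> show "atniss_win (ideal_lattice (P\<lparr>carrier := \<Lambda> - \<mu>\<rparr>)) \<longleftrightarrow>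
      atniss_win (ideal_lattice (P\<lparr>carrier := \<Lambda>\<rparr>))"
    using atniss_win_iff[of \<Lambda>] atniss_win_iff[of "\<Lambda> - \<mu>"] by auto
qed

end
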